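(* Let $G$ be a graph and let $H$ be an attachment set of $G$. Then $$\eta(\mathfrak{a}(G,H))=\eta(\mathfrak{a}^2(G,H)).$$
   Context: All graphs are finite and simple (not necessarily connected). The nullity $\eta(G)$ of a graph $G$ is $\dim\ker A(G)$, where $A(G)$ is the (real) adjacency matrix of $G$. An attachment set of $G$ is a cyclic $h$-tuple $H=(v_1,\dots,v_h)$ of vertices of $G$ with $h\ge 2$, in which a vertex may occur more than once. The altan $\mathfrak{a}(G,H)$ is the pair $(G',H')$, where $G'$ is the graph with vertex set $V(G')=V(G)\sqcup\{x_1,\dots,x_h\}\sqcup\{y_1,\dots,y_h\}$ (disjoint union, all $x_i$, $y_i$ being new distinct vertices) and edge set $E(G')=E(G)\sqcup\{v_ix_i,\,x_iy_i : 1\le i\le h\}\sqcup\{y_ix_{i+1} : 1\le i<h\}\sqcup\{y_hx_1\}$, and $H'=(y_1,\dots,y_h)$ is the induced attachment set, which is an attachment set of $G'$. The second altan is $\mathfrak{a}^2(G,H)=\mathfrak{a}(G',H')=\mathfrak{a}(\mathfrak{a}(G,H))$. The nullity of a pair (graph, attachment set) means the nullity of its graph. *)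

theory Defs
  imports "Graph_Theory.Pair_Digraph" "Jordan_Normal_Form.Matrix_Kernel"
begin

text \<open>
  A finite simple graph is a \<^locale>\<open>pair_graph\<close>: finitely many vertices, a symmetric loop-free
  arc relation, each undirected edge being represented by its two opposite arcs.
\<close>

definition adjacency_mat :: "'a pair_pre_digraph \<Rightarrow> 'a list \<Rightarrow> real mat" where
  "adjacency_mat G vs =
     mat (length vs) (length vs) (\<lambda>(i, j). if (vs ! i, vs ! j) \<in> parcs G then 1 else 0)"

definition vertex_enum :: "'a pair_pre_digraph \<Rightarrow> 'a list" where
  "vertex_enum G = (SOME vs. distinct vs \<and> set vs = pverts G)"

text \<open>The choice of the enumeration is immaterial, see \<open>nullity_eq_kernel_dim\<close> below.\<close>

definition nullity :: "'a pair_pre_digraph \<Rightarrow> nat" where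
  "nullity G = kernel_dim (adjacency_mat G (vertex_enum G))"

text \<open>A cyclic tuple is given by a list that reads it off from one of its positions.\<close>

definition attachment_set :: "'a pair_pre_digraph \<Rightarrow> 'a list \<Rightarrow> bool" where
  "attachment_set G H \<longleftrightarrow> 2 \<le> length H \<and> set H \<subseteq> pverts G"

text \<open>The new vertices are indexed from \<open>0\<close> to \<open>h - 1\<close>.\<close>

datatype 'a altan_vertex = Old 'a | NewX nat | NewY nat

definition altan_graph ::
  "'a pair_pre_digraph \<Rightarrow> 'a list \<Rightarrow> 'a altan_vertex pair_pre_digraph" where
  "altan_graph G H =
     (let h = length H;
          E = {(Old (H ! i), NewX i) |i. i < h} \<union> {(NewX i, NewY i) |i. i < h}
            \<union> {(NewY i, NewX (Suc i)) |i. Suc i < h} \<union> {(NewY (h - 1), NewX 0)}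
      in \<lparr>pverts = Old ` pverts G \<union> NewX ` {..<h} \<union> NewY ` {..<h},
          parcs = map_prod Old Old ` parcs G \<union> E \<union> E\<inverse>\<rparr>)"

definition altan ::
  "'a pair_pre_digraph \<times> 'a list \<Rightarrow> 'a altan_vertex pair_pre_digraph \<times> 'a altan_vertex list" where
  "altan = (\<lambda>(G, H). (altan_graph G H, map NewY [0..<length H]))"

definition altan2 ::
  "'a pair_pre_digraph \<times> 'a list \<Rightarrow>
   'a altan_vertex altan_vertex pair_pre_digraph \<times> 'a altan_vertex altan_vertex list" where
  "altan2 P = altan (altan P)"

lemma attachment_set_altan:
  assumes "attachment_set G H"
  shows "attachment_set (fst (altan (G, H))) (snd (altan (G, H)))"
  using assms by (auto simp: attachment_set_def altan_def altan_graph_def Let_def)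

lemma pair_graph_altan:
  assumes "pair_graph G" "attachment_set G H"
  shows "pair_graph (fst (altan (G, H)))"
proof -
  interpret pair_graph G by fact
  define h where "h = length H"
  have h: "2 \<le> h" and H: "\<And>i. i < h \<Longrightarrow> H ! i \<in> pverts G"
    using assms(2) by (auto simp: attachment_set_def h_def)
  define E :: "('a altan_vertex \<times> 'a altan_vertex) set" where "E = {(Old (H ! i), NewX i) |i. i < h} \<union> {(NewX i, NewY i) |i. i < h}
            \<union> {(NewY i, NewX (Suc i)) |i. Suc i < h} \<union> {(NewY (h - 1), NewX 0)}"
  define G' where "G' = fst (altan (G, H))"
  have verts: "pverts G' = Old ` pverts G \<union> NewX ` {..<h} \<union> NewY ` {..<h}"
    and arcs: "parcs G' = map_prod Old Old ` parcs G \<union> E \<union> E\<inverse>"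
    by (auto simp: G'_def altan_def altan_graph_def Let_def E_def h_def)
  have E: "E \<subseteq> pverts G' \<times> pverts G'"
    using h H by (auto simp: E_def verts)
  have old: "map_prod Old Old ` parcs G \<subseteq> pverts G' \<times> pverts G'"
    using arc_fst_in_verts arc_snd_in_verts by (fastforce simp: verts)
  have wf: "parcs G' \<subseteq> pverts G' \<times> pverts G'"
    using E old by (auto simp: arcs)
  have fin: "finite (pverts G')"
    using pair_finite_verts by (simp add: verts)
  have sym: "sym (parcs G')"
    using pair_sym_arcs by (auto simp: sym_def symmetric_def arcs)
  have loopfree: "fst e \<noteq> snd e" if "e \<in> parcs G'" for e
    using that pair_no_loops by (fastforce simp: arcs E_def)
  have "pair_graph G'"
    using wf fin sym loopfree finite_subset[OF wf]
    by unfold_locales (auto simp: symmetric_def)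
  then show ?thesis by (simp add: G'_def)
qed

lemma vertex_enum:
  assumes "finite (pverts G)"
  shows "distinct (vertex_enum G)" "set (vertex_enum G) = pverts G"
proof -
  have "\<exists>vs. distinct vs \<and> set vs = pverts G"
    using finite_distinct_list[OF assms] by blast
  from someI_ex[OF this]
  show "distinct (vertex_enum G)" "set (vertex_enum G) = pverts G"
    by (simp_all add: vertex_enum_def)
qed

lemma kernel_dim_adjacency_mat_cong:
  assumes "distinct vs" "distinct ws" "set vs = set ws"
  shows "kernel_dim (adjacency_mat G vs) = kernel_dim (adjacency_mat G ws)"
proof -
  define n where "n = length vs"
  have n': "length ws = n" using assms by (metis distinct_card n_def)
  define P :: "real mat" where "P = mat n n (\<lambda>(i, j). if vs ! i = ws ! j then 1 else 0)"
  define Q :: "real mat" where "Q = mat n n (\<lambda>(i, j). if ws ! i = vs ! j then 1 else 0)"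
  define B where "B = adjacency_mat G ws"
  have "\<forall>i\<in>{..<n}. \<exists>j\<in>{..<n}. vs ! i = ws ! j"
    using assms(3) n' unfolding n_def
    by (metis in_set_conv_nth lessThan_iff)
  then obtain p where p: "\<And>i. i < n \<Longrightarrow> p i < n" "\<And>i. i < n \<Longrightarrow> vs ! i = ws ! p i"
    by (metis lessThan_iff)
  have "\<forall>i\<in>{..<n}. \<exists>j\<in>{..<n}. ws ! i = vs ! j"
    using assms(3) n' unfolding n_def
    by (metis in_set_conv_nth lessThan_iff)
  then obtain q where q: "\<And>i. i < n \<Longrightarrow> q i < n" "\<And>i. i < n \<Longrightarrow> ws ! i = vs ! q i"
    by (metis lessThan_iff)
  have eqv: "vs ! i = vs ! j \<longleftrightarrow> i = j" if "i < n" "j < n" for i j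
    using that assms(1) by (simp add: n_def nth_eq_iff_index_eq)
  have eqw: "ws ! i = ws ! j \<longleftrightarrow> i = j" if "i < n" "j < n" for i j
    using that assms(2) n' by (simp add: nth_eq_iff_index_eq)
  have carrier: "P \<in> carrier_mat n n" "Q \<in> carrier_mat n n" "B \<in> carrier_mat n n"
    "adjacency_mat G vs \<in> carrier_mat n n"
    using n' by (auto simp: P_def Q_def B_def adjacency_mat_def n_def)
  have Pd: "P $$ (i, j) = (if j = p i then 1 else 0)" if "i < n" "j < n" for i j
    using that p eqw by (auto simp: P_def)
  have Qd: "Q $$ (i, j) = (if j = q i then 1 else 0)" if "i < n" "j < n" for i j
    using that q eqv by (auto simp: Q_def)
  have Qc: "Q $$ (i, j) = (if i = p j then 1 else 0)" if "i < n" "j < n" for i j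
    using that p eqw by (auto simp: Q_def)
  have mult: "(M * N) $$ (i, j) = (\<Sum>k\<in>{0..<n}. M $$ (i, k) * N $$ (k, j))"
    if "M \<in> carrier_mat n n" "N \<in> carrier_mat n n" "i < n" "j < n" for M N :: "real mat" and i j
    using that by (auto simp: scalar_prod_def)
  have PN: "(P * N) $$ (i, j) = N $$ (p i, j)"
    if "N \<in> carrier_mat n n" "i < n" "j < n" for N i j
  proof -
    have "(P * N) $$ (i, j) = (\<Sum>k\<in>{0..<n}. if k = p i then N $$ (k, j) else 0)"
      unfolding mult[OF carrier(1) that(1) that(2,3)]
      by (rule sum.cong) (use that in \<open>auto simp: Pd\<close>)
    also have "\<dots> = N $$ (p i, j)" using p that by simp
    finally show ?thesis .
  qed
  have QN: "(Q * N) $$ (i, j) = N $$ (q i, j)"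
    if "N \<in> carrier_mat n n" "i < n" "j < n" for N i j
  proof -
    have "(Q * N) $$ (i, j) = (\<Sum>k\<in>{0..<n}. if k = q i then N $$ (k, j) else 0)"
      unfolding mult[OF carrier(2) that(1) that(2,3)]
      by (rule sum.cong) (use that in \<open>auto simp: Qd\<close>)
    also have "\<dots> = N $$ (q i, j)" using q that by simp
    finally show ?thesis .
  qed
  have NQ: "(N * Q) $$ (i, j) = N $$ (i, p j)"
    if "N \<in> carrier_mat n n" "i < n" "j < n" for N i j
  proof -
    have "(N * Q) $$ (i, j) = (\<Sum>k\<in>{0..<n}. if k = p j then N $$ (i, k) else 0)"
      unfolding mult[OF that(1) carrier(2) that(2,3)]
      by (rule sum.cong) (use that in \<open>auto simp: Qc\<close>)
    also have "\<dots> = N $$ (i, p j)" using p that by simp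
    finally show ?thesis .
  qed
  have PQ: "P * Q = 1\<^sub>m n"
  proof (rule eq_matI)
    fix i j assume "i < dim_row (1\<^sub>m n :: real mat)" "j < dim_col (1\<^sub>m n :: real mat)"
    then have ij: "i < n" "j < n" by auto
    have "ws ! p i = vs ! j \<longleftrightarrow> i = j" using ij p(2) eqv by metis
    then show "(P * Q) $$ (i, j) = 1\<^sub>m n $$ (i, j)"
      using ij p(1) unfolding PN[OF carrier(2) ij] by (simp add: Q_def)
  qed (use carrier in auto)
  have QP: "Q * P = 1\<^sub>m n"
  proof (rule eq_matI)
    fix i j assume "i < dim_row (1\<^sub>m n :: real mat)" "j < dim_col (1\<^sub>m n :: real mat)"
    then have ij: "i < n" "j < n" by auto
    have "vs ! q i = ws ! j \<longleftrightarrow> i = j" using ij q(2) eqw by metis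
    then show "(Q * P) $$ (i, j) = 1\<^sub>m n $$ (i, j)"
      using ij q(1) unfolding QN[OF carrier(1) ij] by (simp add: P_def)
  qed (use carrier in auto)
  have "adjacency_mat G vs = P * B * Q"
  proof (rule eq_matI)
    fix i j assume "i < dim_row (P * B * Q)" "j < dim_col (P * B * Q)"
    then have ij: "i < n" "j < n" using carrier by auto
    have "(P * B * Q) $$ (i, j) = B $$ (p i, p j)"
      unfolding NQ[OF mult_carrier_mat[OF carrier(1,3)] ij] PN[OF carrier(3) ij(1) p(1)[OF ij(2)]] ..
    also have "\<dots> = adjacency_mat G vs $$ (i, j)"
      using ij p n' by (simp add: B_def adjacency_mat_def n_def)
    finally show "adjacency_mat G vs $$ (i, j) = (P * B * Q) $$ (i, j)" by simp
  qed (use carrier in auto)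
  then have "similar_mat_wit (adjacency_mat G vs) B P Q"
    using carrier PQ QP by (intro similar_mat_witI) auto
  from similar_mat_wit_kernel_dim[OF carrier(4) this]
  show ?thesis
    using carrier by (simp add: kernel_dim_def B_def)
qed

lemma nullity_eq_kernel_dim:
  assumes "distinct vs" "set vs = pverts G"
  shows "nullity G = kernel_dim (adjacency_mat G vs)"
proof -
  have "finite (pverts G)" using assms(2) by (metis List.finite_set)
  from vertex_enum[OF this] show ?thesis
    unfolding nullity_def using assms by (intro kernel_dim_adjacency_mat_cong) auto
qed

end

theory Submission
  imports Defs
begin

text \<open>
  A kernel vector of an adjacency matrix is a function on the vertices whose values sum to zero
  over the neighbours of each vertex. On the altan such a function consists of three parts:
  \<open>u\<close> on the old vertices, \<open>x\<close> and \<open>y\<close> on the two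
  kinds of new vertices. Write \<open>(C w) i = w i + w (i - 1)\<close> with indices modulo
  \<open>h\<close>, and \<open>C\<^sup>T\<close> for its transpose
  \<open>w i + w (i + 1)\<close>. The conditions at the new vertices are
  \<open>u (v\<^sub>i) + (C y) i = 0\<close> and \<open>C\<^sup>T x = 0\<close>. On the second
  altan two further parts \<open>x'\<close>, \<open>y'\<close> appear, and the conditions become
  \<open>u (v\<^sub>i) + (C y) i = 0\<close>, \<open>C\<^sup>T x + x' = 0\<close>,
  \<open>y + C y' = 0\<close> and \<open>C\<^sup>T x' = 0\<close>; the condition at the old
  vertices of \<open>G\<close> is the same in both cases.

  The vector \<open>x'\<close> lies in the kernel and in the image of \<open>C\<^sup>T\<close>.
  These are orthogonal because \<open>C\<close> is a circulant, so \<open>x' = 0\<close>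
  (\<open>zero_if_cyc_harmonic_and_cyc_sum\<close>). Hence \<open>(u, x, y)\<close> is a null
  function of the first altan, with the additional requirement that \<open>y = - C y'\<close>
  for some \<open>y'\<close>. For odd \<open>h\<close> the map \<open>C\<close> is invertible and
  nothing has changed. For even \<open>h\<close> both the kernel and a complement of the image
  of \<open>C\<close> are spanned by the alternating vector \<open>a = (1, -1, 1, \<dots>)\<close>. So
  \<open>y\<close>, which the first altan determines only up to multiples of \<open>a\<close>,
  loses one degree of freedom, and \<open>y'\<close>, determined up to multiples of
  \<open>a\<close>, gives it back. The map
  \<open>(u, x, y, x', y') \<mapsto> (u, x, y + \<langle>a, y'\<rangle> a)\<close>
  (\<open>altan_collapse\<close>) carries out this exchange; it is a linear bijection between the
  two spaces of null functions. Reading \<open>a\<close> as zero for odd \<open>h\<close> makes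
  the same formula work in both cases.
\<close>

section \<open>Null functions of a graph\<close>

definition neighbour_sum :: "'a pair_pre_digraph \<Rightarrow> ('a \<Rightarrow> real) \<Rightarrow> 'a \<Rightarrow> real" where
  "neighbour_sum G f v = sum f {w. (v, w) \<in> parcs G}"

definition null_function :: "'a pair_pre_digraph \<Rightarrow> ('a \<Rightarrow> real) \<Rightarrow> bool" where
  "null_function G f \<longleftrightarrow> (\<forall>v\<in>pverts G. neighbour_sum G f v = 0)"

lemma vec_in_kernel_iff_null_function:
  assumes "pair_graph G" "distinct vs" "set vs = pverts G"
    and f: "\<And>i. i < length vs \<Longrightarrow> f (vs ! i) = x $ i"
    and x: "x \<in> carrier_vec (length vs)"
  shows "x \<in> mat_kernel (adjacency_mat G vs) \<longleftrightarrow> null_function G f"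
proof -
  interpret pair_graph G by fact
  let ?n = "length vs"
  have "(adjacency_mat G vs *\<^sub>v x) $ i = neighbour_sum G f (vs ! i)" if i: "i < ?n" for i
  proof -
    have "(adjacency_mat G vs *\<^sub>v x) $ i
        = (\<Sum>j<?n. if (vs ! i, vs ! j) \<in> parcs G then f (vs ! j) else 0)"
      using i x f
      by (auto simp: adjacency_mat_def scalar_prod_def lessThan_atLeast0 intro!: sum.cong)
    also have "\<dots> = (\<Sum>w\<in>pverts G. if (vs ! i, w) \<in> parcs G then f w else 0)"
      using bij_betw_nth[OF assms(2) refl assms(3)[symmetric]]
      by (rule sum.reindex_bij_betw)
    also have "\<dots> = neighbour_sum G f (vs ! i)"
      unfolding neighbour_sum_def
      by (rule sum.mono_neutral_cong_right) (auto dest: in_arcsD2)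
    finally show ?thesis .
  qed
  then have "adjacency_mat G vs *\<^sub>v x = 0\<^sub>v ?n \<longleftrightarrow> (\<forall>i<?n. neighbour_sum G f (vs ! i) = 0)"
    by (auto simp: vec_eq_iff adjacency_mat_def simp del: index_mult_mat_vec)
  also have "\<dots> \<longleftrightarrow> null_function G f"
    unfolding null_function_def assms(3)[symmetric] all_set_conv_all_nth ..
  finally show ?thesis
    using x by (simp add: mat_kernel_def adjacency_mat_def)
qed

text \<open>
  Null functions are compared here without choosing an enumeration of the vertices: \<open>T\<close>
  acts on functions on the whole type, and since the values off the graph are junk, \<open>T\<close>
  must not look at them, and injectivity and surjectivity are only required on the vertices.
  Transported to coordinate vectors, \<open>T\<close> is then an isomorphism between the kernels of
  the adjacency matrices.
\<close>

lemma nullity_eqI: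
  fixes T :: "('a \<Rightarrow> real) \<Rightarrow> 'b \<Rightarrow> real"
  assumes G: "pair_graph G" and G': "pair_graph G'"
    and local: "\<And>f g w. (\<And>v. v \<in> pverts G \<Longrightarrow> f v = g v) \<Longrightarrow> w \<in> pverts G' \<Longrightarrow> T f w = T g w"
    and add: "\<And>f g w. w \<in> pverts G' \<Longrightarrow> T (\<lambda>v. f v + g v) w = T f w + T g w"
    and scale: "\<And>c f w. w \<in> pverts G' \<Longrightarrow> T (\<lambda>v. c * f v) w = c * T f w"
    and null: "\<And>f. null_function G f \<Longrightarrow> null_function G' (T f)"
    and inj: "\<And>f v. null_function G f \<Longrightarrow> (\<And>w. w \<in> pverts G' \<Longrightarrow> T f w = 0)
                \<Longrightarrow> v \<in> pverts G \<Longrightarrow> f v = 0"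
    and surj: "\<And>g. null_function G' g
                \<Longrightarrow> \<exists>f. null_function G f \<and> (\<forall>w\<in>pverts G'. T f w = g w)"
  shows "nullity G = nullity G'"
proof -
  interpret G: pair_graph G by fact
  interpret G': pair_graph G' by fact
  obtain vs where vs: "distinct vs" "set vs = pverts G"
    using finite_distinct_list[OF G.pair_finite_verts] by blast
  obtain ws where ws: "distinct ws" "set ws = pverts G'"
    using finite_distinct_list[OF G'.pair_finite_verts] by blast
  let ?n = "length vs" and ?m = "length ws"
  let ?A = "adjacency_mat G vs" and ?B = "adjacency_mat G' ws"
  interpret A: kernel ?n ?n ?A by unfold_locales (simp add: adjacency_mat_def)
  interpret B: kernel ?m ?m ?B by unfold_locales (simp add: adjacency_mat_def)
  define fn :: "real vec \<Rightarrow> 'a \<Rightarrow> real"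
    where "fn x = (\<lambda>v. \<Sum>i<?n. if vs ! i = v then x $ i else 0)" for x
  define S where "S x = vec ?m (\<lambda>j. T (fn x) (ws ! j))" for x
  have fn_nth: "fn x (vs ! i) = x $ i" if "i < ?n" for x i
  proof -
    have "fn x (vs ! i) = (\<Sum>j<?n. if j = i then x $ j else 0)"
      unfolding fn_def by (rule sum.cong) (use that vs(1) in \<open>auto simp: nth_eq_iff_index_eq\<close>)
    then show ?thesis using that by simp
  qed
  have fn_eq: "fn x v = f v" if "\<And>i. i < ?n \<Longrightarrow> x $ i = f (vs ! i)" "v \<in> pverts G" for x f v
  proof -
    obtain i where "i < ?n" "v = vs ! i"
      using \<open>v \<in> pverts G\<close> vs(2) by (metis in_set_conv_nth)
    then show ?thesis using that(1) fn_nth by simp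
  qed
  have ws_nth: "ws ! j \<in> pverts G'" if "j < ?m" for j
    using that ws(2) nth_mem by blast
  have ker_A: "x \<in> mat_kernel ?A \<longleftrightarrow> x \<in> carrier_vec ?n \<and> null_function G (fn x)" for x
    using vec_in_kernel_iff_null_function[OF G vs, of "fn x" x] fn_nth[of _ x]
      mat_kernel_carrier[OF A.A] by auto
  have ker_B: "vec ?m (\<lambda>j. g (ws ! j)) \<in> mat_kernel ?B \<longleftrightarrow> null_function G' g" for g
    by (rule vec_in_kernel_iff_null_function[OF G' ws]) auto
  have S_ker: "S x \<in> mat_kernel ?B" if "x \<in> mat_kernel ?A" for x
    using null[of "fn x"] that ker_A[of x] ker_B[of "T (fn x)"] by (simp add: S_def)
  have S_add: "S (x + y) = S x + S y" if "x \<in> mat_kernel ?A" "y \<in> mat_kernel ?A" for x y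
  proof -
    have xy: "dim_vec x = ?n" "dim_vec y = ?n" using that by (auto simp: ker_A)
    have "T (fn (x + y)) w = T (fn x) w + T (fn y) w" if "w \<in> pverts G'" for w
    proof -
      have "T (fn (x + y)) w = T (\<lambda>v. fn x v + fn y v) w"
        by (rule local[OF _ that], rule fn_eq) (auto simp: fn_nth xy)
      then show ?thesis using add[OF that] by simp
    qed
    then show ?thesis unfolding S_def by (auto simp: vec_eq_iff ws_nth)
  qed
  have S_scale: "S (c \<cdot>\<^sub>v x) = c \<cdot>\<^sub>v S x" if "x \<in> mat_kernel ?A" for c x
  proof -
    have x: "dim_vec x = ?n" using that by (auto simp: ker_A)
    have "T (fn (c \<cdot>\<^sub>v x)) w = c * T (fn x) w" if "w \<in> pverts G'" for w
    proof -
      have "T (fn (c \<cdot>\<^sub>v x)) w = T (\<lambda>v. c * fn x v) w"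
        by (rule local[OF _ that], rule fn_eq) (auto simp: fn_nth x)
      then show ?thesis using scale[OF that] by simp
    qed
    then show ?thesis unfolding S_def by (auto simp: vec_eq_iff ws_nth)
  qed
  have "S \<in> module_hom class_ring A.VK B.VK"
    using S_ker S_add S_scale by (auto simp: LinearCombinations.module_hom_def module_vec_simps)
  then interpret S: linear_map class_ring A.VK B.VK S
    by unfold_locales
  have zero: "x = 0\<^sub>v ?n" if x: "x \<in> mat_kernel ?A" and "S x = 0\<^sub>v ?m" for x
  proof -
    have "T (fn x) w = 0" if "w \<in> pverts G'" for w
    proof -
      obtain j where "j < ?m" "w = ws ! j"
        using \<open>w \<in> pverts G'\<close> ws(2) by (metis in_set_conv_nth)
      then show ?thesis
        using arg_cong[OF \<open>S x = 0\<^sub>v ?m\<close>, of "\<lambda>y. y $ j"] by (simp add: S_def)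
    qed
    then have "fn x v = 0" if "v \<in> pverts G" for v
      using inj[of "fn x" v] x that ker_A[of x] by simp
    then have "x $ i = 0" if "i < ?n" for i
      using fn_nth[OF that, of x] that vs(2) nth_mem by force
    then show ?thesis using x by (auto simp: ker_A)
  qed
  have "S (0\<^sub>v ?n) = 0\<^sub>v ?m"
    using S.T0_is_0 by simp
  moreover have "0\<^sub>v ?n \<in> mat_kernel ?A"
    using A.Ker.zero_closed by simp
  ultimately have "{x \<in> mat_kernel ?A. S x = 0\<^sub>v ?m} = {0\<^sub>v ?n}"
    using zero by blast
  then have "inj_on S (mat_kernel ?A)"
    using S.Ke0_imp_inj by (simp add: S.ker_def)
  moreover have "S ` mat_kernel ?A = mat_kernel ?B"
  proof
    show "mat_kernel ?B \<subseteq> S ` mat_kernel ?A"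
    proof
      fix y assume y: "y \<in> mat_kernel ?B"
      then have dim: "y \<in> carrier_vec ?m" using mat_kernel_carrier[OF B.A] by blast
      define g where "g w = (\<Sum>i<?m. if ws ! i = w then y $ i else 0)" for w
      have g: "g (ws ! j) = y $ j" if "j < ?m" for j
      proof -
        have "g (ws ! j) = (\<Sum>i<?m. if i = j then y $ i else 0)"
          unfolding g_def by (rule sum.cong) (use that ws(1) in \<open>auto simp: nth_eq_iff_index_eq\<close>)
        then show ?thesis using that by simp
      qed
      have y_eq: "y = vec ?m (\<lambda>j. g (ws ! j))" using dim g by (auto simp: vec_eq_iff)
      then have "null_function G' g" using y ker_B[of g] by simp
      then obtain f where f: "null_function G f" "\<forall>w\<in>pverts G'. T f w = g w"
        using surj by blast
      define x where "x = vec ?n (\<lambda>i. f (vs ! i))"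
      have "x \<in> mat_kernel ?A"
        using f(1) vec_in_kernel_iff_null_function[OF G vs, of f x] by (simp add: x_def)
      moreover have "T (fn x) w = g w" if "w \<in> pverts G'" for w
      proof -
        have "T (fn x) w = T f w"
          by (rule local[OF _ that], rule fn_eq) (auto simp: x_def)
        then show ?thesis using f(2) that by simp
      qed
      then have "S x = y" unfolding S_def y_eq by (auto simp: vec_eq_iff ws_nth)
      ultimately show "y \<in> S ` mat_kernel ?A" by blast
    qed
  qed (use S_ker in auto)
  moreover have "A.Ker.fin_dim"
    using kernel_basis_exists[OF A.A] by (auto simp: A.Ker.fin_dim_def A.Ker.basis_def)
  ultimately have "kernel_dim ?A = kernel_dim ?B"
    using S.dim_eq by simp
  then show ?thesis
    using nullity_eq_kernel_dim[OF vs] nullity_eq_kernel_dim[OF ws] by simp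
qed

section \<open>Sums of cyclically adjacent entries\<close>

definition cyc_prev :: "nat \<Rightarrow> nat \<Rightarrow> nat" where
  "cyc_prev h i = (if i = 0 then h - 1 else i - 1)"

definition cyc_next :: "nat \<Rightarrow> nat \<Rightarrow> nat" where
  "cyc_next h i = (if Suc i < h then Suc i else 0)"

lemma cyc_prev_less: "i < h \<Longrightarrow> cyc_prev h i < h"
  by (cases i) (simp_all add: cyc_prev_def)

lemma cyc_next_less: "i < h \<Longrightarrow> cyc_next h i < h"
  by (simp add: cyc_next_def)

lemma cyc_next_prev: "i < h \<Longrightarrow> cyc_next h (cyc_prev h i) = i"
  by (cases i) (simp_all add: cyc_prev_def cyc_next_def)

lemma cyc_prev_next: "i < h \<Longrightarrow> cyc_prev h (cyc_next h i) = i"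
  by (cases "Suc i < h") (simp_all add: cyc_prev_def cyc_next_def)

lemma sum_cyc_prev: "(\<Sum>i<h. f (cyc_prev h i)) = (\<Sum>i<h. f i)" for f :: "nat \<Rightarrow> real"
  by (rule sum.reindex_bij_witness[of _ "cyc_next h" "cyc_prev h"])
    (auto simp: cyc_prev_less cyc_next_less cyc_next_prev cyc_prev_next)

lemma sum_cyc_next: "(\<Sum>i<h. f (cyc_next h i)) = (\<Sum>i<h. f i)" for f :: "nat \<Rightarrow> real"
  by (rule sum.reindex_bij_witness[of _ "cyc_prev h" "cyc_next h"])
    (auto simp: cyc_prev_less cyc_next_less cyc_next_prev cyc_prev_next)

text \<open>
  The kernel of \<open>w \<mapsto> (\<lambda>i. w i + w (cyc_prev h i))\<close> is spanned by this
  vector. It is zero for odd \<open>h\<close>, since going once around the cycle then forces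
  \<open>w 0 = - w 0\<close>; with this convention
  the statements below hold for both parities.
\<close>

definition alt :: "nat \<Rightarrow> nat \<Rightarrow> real" where
  "alt h i = (if even h then (- 1) ^ i else 0)"

lemma alt_cyc_prev: "i < h \<Longrightarrow> alt h (cyc_prev h i) = - alt h i"
  by (cases i; cases h) (auto simp: alt_def cyc_prev_def)

lemma sum_alt_alt_eq_0_imp:
  assumes "(\<Sum>i<h. alt h i * alt h i) = 0" "i < h"
  shows "alt h i = 0"
  using assms sum_nonneg_eq_0_iff[of "{..<h}" "\<lambda>i. alt h i * alt h i"] by simp

text \<open>
  Shifting \<open>alt h\<close> changes its sign, so after reindexing the two halves of the sum
  cancel: the image of the cyclic sum map is orthogonal to \<open>alt h\<close>.
\<close>

lemma sum_alt_mult_cyc_prev: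
  "(\<Sum>i<h. alt h i * (w i + w (cyc_prev h i))) = 0"
proof -
  have "(\<Sum>i<h. alt h i * w (cyc_prev h i)) = (\<Sum>i<h. - (alt h (cyc_prev h i) * w (cyc_prev h i)))"
    by (rule sum.cong) (auto simp: alt_cyc_prev)
  also have "\<dots> = (\<Sum>i<h. - (alt h i * w i))"
    by (rule sum_cyc_prev)
  finally show ?thesis by (simp add: distrib_left sum.distrib sum_negf)
qed

lemma cyc_sum_eq_0_imp_alt:
  fixes w :: "nat \<Rightarrow> real"
  assumes "\<And>i. i < h \<Longrightarrow> w i + w (cyc_prev h i) = 0" "i < h"
  shows "w i = w 0 * alt h i"
proof -
  have pow: "w i = (- 1) ^ i * w 0" if "i < h" for i
    using that
  proof (induction i)
    case (Suc i)
    then show ?case using assms(1)[of "Suc i"] by (simp add: cyc_prev_def)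
  qed simp
  show ?thesis
  proof (cases "even h")
    case False
    then have "w (h - 1) = w 0" using pow[of "h - 1"] assms(2) by simp
    then have "w 0 = 0" using assms(1)[of 0] assms(2) by (simp add: cyc_prev_def)
    then show ?thesis using pow[OF assms(2)] by simp
  qed (use pow[OF assms(2)] in \<open>simp add: alt_def\<close>)
qed

text \<open>
  Conversely, orthogonality to \<open>alt h\<close> suffices for solvability. Multiplied by
  \<open>(- 1) ^ i\<close>, the equations say that consecutive values differ by
  \<open>(- 1) ^ i * z i\<close>, so the solution is a partial sum plus a constant, and only the
  equation that closes the cycle has to be checked.
\<close>

lemma ex_cyc_sum_eq:
  fixes z :: "nat \<Rightarrow> real"
  assumes "(\<Sum>i<h. alt h i * z i) = 0"
  shows "\<exists>w. \<forall>i<h. w i + w (cyc_prev h i) = z i"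
proof -
  define p where "p i = (\<Sum>j<i. (- 1) ^ j * z j)" for i :: nat
  \<comment> \<open>The equation at \<open>i = 0\<close> forces the constant \<open>- p h / 2\<close> for odd
    \<open>h\<close>; for even \<open>h\<close> it requires \<open>p h = 0\<close>, which is the hypothesis.\<close>
  define w where "w i = (- 1) ^ i * (p (Suc i) - p h / 2)" for i
  have "w i + w (cyc_prev h i) = z i" if i: "i < h" for i
  proof (cases i)
    case 0
    have "p h = 0" if "even h" using assms that by (simp add: p_def alt_def)
    moreover have "Suc (h - 1) = h" using i by simp
    ultimately show ?thesis
      using i 0 by (cases "even h") (auto simp: w_def cyc_prev_def p_def)
  next
    case (Suc k)
    have "w i + w (cyc_prev h i) = (- 1) ^ i * (p (Suc i) - p i)"
      using Suc by (simp add: w_def cyc_prev_def algebra_simps)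
    also have "\<dots> = (- 1) ^ i * ((- 1) ^ i * z i)" by (simp add: p_def)
    also have "\<dots> = z i" by simp
    finally show ?thesis .
  qed
  then show ?thesis by blast
qed

text \<open>
  The hypotheses place \<open>x'\<close> both in the kernel and in the image of the map
  \<open>x \<mapsto> (\<lambda>i. x i + x (cyc_next h i))\<close>. These are orthogonal: by the first
  hypothesis a shift turns \<open>x'\<close> into \<open>- x'\<close>, so the two halves of
  the inner product of \<open>x'\<close> with \<open>x i + x (cyc_next h i)\<close> cancel. Hence the sum of
  squares of \<open>x'\<close> vanishes.
\<close>

lemma zero_if_cyc_harmonic_and_cyc_sum:
  fixes x x' :: "nat \<Rightarrow> real"
  assumes x': "\<And>i. i < h \<Longrightarrow> x' i + x' (cyc_next h i) = 0"
    and x: "\<And>i. i < h \<Longrightarrow> x i + x (cyc_next h i) + x' i = 0"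
    and "i < h"
  shows "x' i = 0"
proof -
  have "(\<Sum>i<h. x' i * x (cyc_next h i)) = (\<Sum>i<h. - (x' (cyc_next h i) * x (cyc_next h i)))"
  proof (rule sum.cong)
    fix i assume "i \<in> {..<h}"
    then have "x' i = - x' (cyc_next h i)" using x'[of i] by simp
    then show "x' i * x (cyc_next h i) = - (x' (cyc_next h i) * x (cyc_next h i))" by simp
  qed simp
  also have "\<dots> = (\<Sum>i<h. - (x' i * x i))"
    by (rule sum_cyc_next)
  finally have *: "(\<Sum>i<h. x' i * x i + x' i * x (cyc_next h i)) = 0"
    by (simp add: sum.distrib sum_negf)
  have "(\<Sum>i<h. x' i * x' i) = (\<Sum>i<h. - (x' i * x i + x' i * x (cyc_next h i)))"
  proof (rule sum.cong)
    fix i assume "i \<in> {..<h}"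
    then have "x' i = - (x i + x (cyc_next h i))" using x[of i] by simp
    then have "x' i * x' i = x' i * - (x i + x (cyc_next h i))" by (rule arg_cong)
    then show "x' i * x' i = - (x' i * x i + x' i * x (cyc_next h i))"
      by (simp only: mult_minus_right distrib_left)
  qed simp
  also have "\<dots> = 0" using * by (simp only: sum_negf minus_zero)
  finally have "(\<Sum>i<h. x' i * x' i) = 0" .
  then show ?thesis using \<open>i < h\<close> by (simp add: sum_nonneg_eq_0_iff)
qed

section \<open>Null functions of an altan\<close>

lemma altan_simps:
  "fst (altan (G, H)) = altan_graph G H"
  "fst (altan2 (G, H)) = altan_graph (altan_graph G H) (map NewY [0..<length H])"
  by (simp_all add: altan_def altan2_def)

lemma pverts_altan_graph:
  "pverts (altan_graph G H) = Old ` pverts G \<union> NewX ` {..<length H} \<union> NewY ` {..<length H}"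
  by (simp add: altan_graph_def Let_def)

lemma neighbour_sum_altan_Old:
  assumes "pair_graph G"
  shows "neighbour_sum (altan_graph G H) f (Old v)
    = neighbour_sum G (\<lambda>w. f (Old w)) v + (\<Sum>i | i < length H \<and> H ! i = v. f (NewX i))"
proof -
  interpret pair_graph G by fact
  have "finite {w. (v, w) \<in> parcs G}"
    by (rule finite_subset[OF _ pair_finite_verts]) (auto dest: in_arcsD2)
  moreover have "{w. (Old v, w) \<in> parcs (altan_graph G H)}
    = Old ` {w. (v, w) \<in> parcs G} \<union> NewX ` {i. i < length H \<and> H ! i = v}"
    by (auto simp: altan_graph_def Let_def)
  ultimately have "neighbour_sum (altan_graph G H) f (Old v)
    = sum f (Old ` {w. (v, w) \<in> parcs G}) + sum f (NewX ` {i. i < length H \<and> H ! i = v})"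
    unfolding neighbour_sum_def by (auto intro!: sum.union_disjoint)
  then show ?thesis
    by (simp add: neighbour_sum_def sum.reindex inj_on_def)
qed

text \<open>
  An attachment tuple of length one would make the two neighbours \<open>NewY i\<close> and
  \<open>NewY (cyc_prev h i)\<close> coincide.
\<close>

lemma neighbour_sum_altan_NewX:
  assumes "2 \<le> length H" "i < length H"
  shows "neighbour_sum (altan_graph G H) f (NewX i)
    = f (Old (H ! i)) + f (NewY i) + f (NewY (cyc_prev (length H) i))"
proof -
  have "{w. (NewX i, w) \<in> parcs (altan_graph G H)}
    = {Old (H ! i), NewY i, NewY (cyc_prev (length H) i)}"
    using assms by (auto simp: altan_graph_def Let_def cyc_prev_def)
  moreover have "cyc_prev (length H) i \<noteq> i"
    using assms by (auto simp: cyc_prev_def)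
  ultimately show ?thesis by (simp add: neighbour_sum_def)
qed

lemma neighbour_sum_altan_NewY:
  assumes "2 \<le> length H" "i < length H"
  shows "neighbour_sum (altan_graph G H) f (NewY i)
    = f (NewX i) + f (NewX (cyc_next (length H) i))"
proof -
  have "{w. (NewY i, w) \<in> parcs (altan_graph G H)} = {NewX i, NewX (cyc_next (length H) i)}"
    using assms by (auto simp: altan_graph_def Let_def cyc_next_def)
  moreover have "cyc_next (length H) i \<noteq> i"
    using assms by (auto simp: cyc_next_def)
  ultimately show ?thesis by (simp add: neighbour_sum_def)
qed

lemma ball_lessThan: "(\<forall>i\<in>{..<n}. P i) \<longleftrightarrow> (\<forall>i<n. P i)" for n :: nat
  by auto

lemma null_function_altan_iff:
  assumes "pair_graph G" "attachment_set G H"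
  shows "null_function (altan_graph G H) f \<longleftrightarrow>
    (\<forall>v\<in>pverts G. neighbour_sum G (\<lambda>w. f (Old w)) v
        + (\<Sum>i | i < length H \<and> H ! i = v. f (NewX i)) = 0) \<and>
    (\<forall>i<length H. f (Old (H ! i)) + f (NewY i) + f (NewY (cyc_prev (length H) i)) = 0) \<and>
    (\<forall>i<length H. f (NewX i) + f (NewX (cyc_next (length H) i)) = 0)"
  using assms
  by (simp add: null_function_def pverts_altan_graph ball_Un neighbour_sum_altan_Old
      neighbour_sum_altan_NewX neighbour_sum_altan_NewY attachment_set_def ball_lessThan)

text \<open>
  In the second altan the vertex \<open>NewY i\<close> of the first altan is attached exactly once, to
  the outer \<open>NewX i\<close>. So the sum over attachments reduces to a single term there and is
  empty at all other vertices of the first altan.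
\<close>

lemma null_function_altan2_iff:
  assumes "pair_graph G" "attachment_set G H"
  defines "h \<equiv> length H"
  shows "null_function (altan_graph (altan_graph G H) (map NewY [0..<h])) f \<longleftrightarrow>
    (\<forall>v\<in>pverts G. neighbour_sum G (\<lambda>w. f (Old (Old w))) v
        + (\<Sum>i | i < h \<and> H ! i = v. f (Old (NewX i))) = 0) \<and>
    (\<forall>i<h. f (Old (Old (H ! i))) + f (Old (NewY i)) + f (Old (NewY (cyc_prev h i))) = 0) \<and>
    (\<forall>i<h. f (Old (NewX i)) + f (Old (NewX (cyc_next h i))) + f (NewX i) = 0) \<and>
    (\<forall>i<h. f (Old (NewY i)) + f (NewY i) + f (NewY (cyc_prev h i)) = 0) \<and>
    (\<forall>i<h. f (NewX i) + f (NewX (cyc_next h i)) = 0)"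
proof -
  have G': "pair_graph (altan_graph G H)"
    using pair_graph_altan[OF assms(1,2)] by (simp add: altan_simps)
  have H': "attachment_set (altan_graph G H) (map NewY [0..<h])"
    using attachment_set_altan[OF assms(2)] by (simp add: altan_def h_def)
  have "2 \<le> length H" using assms(2) by (simp add: attachment_set_def)
  have Y: "{i. i < h \<and> map NewY [0..<h] ! i = v} = (case v of NewY j \<Rightarrow> {j} \<inter> {..<h} | _ \<Rightarrow> {})"
    for v :: "'a altan_vertex"
    by (auto split: altan_vertex.split)
  show ?thesis
    unfolding null_function_altan_iff[OF G' H']
    using assms(1) \<open>2 \<le> length H\<close>
    by (simp add: Y pverts_altan_graph ball_Un h_def[symmetric] neighbour_sum_altan_Old
      neighbour_sum_altan_NewX neighbour_sum_altan_NewY ball_lessThan)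
qed

section \<open>Collapsing the second altan\<close>

text \<open>
  The correction term is the component of the outer \<open>NewY\<close> values along
  \<open>alt h\<close>, up to scaling. The inner \<open>NewY\<close> values determine the outer ones only up to a
  multiple of \<open>alt h\<close>; this term records that multiple.
\<close>

definition altan_collapse ::
  "nat \<Rightarrow> ('a altan_vertex altan_vertex \<Rightarrow> real) \<Rightarrow> 'a altan_vertex \<Rightarrow> real" where
  "altan_collapse h f w = f (Old w) +
     (case w of NewY i \<Rightarrow> (\<Sum>j<h. alt h j * f (NewY j)) * alt h i | _ \<Rightarrow> 0)"

lemma altan_collapse_simps:
  "altan_collapse h f (Old v) = f (Old (Old v))"
  "altan_collapse h f (NewX i) = f (Old (NewX i))"
  "altan_collapse h f (NewY i)
    = f (Old (NewY i)) + (\<Sum>j<h. alt h j * f (NewY j)) * alt h i"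
  by (simp_all add: altan_collapse_def)

text \<open>
  The outer \<open>NewX\<close> values vanish, so restricting to the first altan already gives a null
  function; the correction is harmless because \<open>alt h\<close> is in the kernel of the cyclic
  sum.
\<close>

lemma altan_collapse_null:
  assumes G: "pair_graph G" "attachment_set G H"
    and f: "null_function (altan_graph (altan_graph G H) (map NewY [0..<length H])) f"
  shows "null_function (altan_graph G H) (altan_collapse (length H) f)"
proof -
  let ?h = "length H"
  note f = f[unfolded null_function_altan2_iff[OF G]]
  have x': "f (NewX i) = 0" if "i < ?h" for i
    by (rule zero_if_cyc_harmonic_and_cyc_sum[of ?h "\<lambda>i. f (NewX i)" "\<lambda>i. f (Old (NewX i))"])
      (use f that in auto)
  show ?thesis
    unfolding null_function_altan_iff[OF G] altan_collapse_simps
    using f x' by (auto simp: alt_cyc_prev)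
qed

text \<open>
  If the collapsed function vanishes, the inner \<open>NewY\<close> values are a multiple of
  \<open>alt h\<close>. Up to sign they are also cyclic sums of the outer ones, hence orthogonal to
  \<open>alt h\<close>, and so zero. The outer \<open>NewY\<close> values then form a multiple of
  \<open>alt h\<close> whose component along \<open>alt h\<close> is zero.
\<close>

lemma altan_collapse_inj:
  assumes G: "pair_graph G" "attachment_set G H"
    and f: "null_function (altan_graph (altan_graph G H) (map NewY [0..<length H])) f"
    and zero: "\<And>w. w \<in> pverts (altan_graph G H) \<Longrightarrow> altan_collapse (length H) f w = 0"
    and v: "v \<in> pverts (altan_graph (altan_graph G H) (map NewY [0..<length H]))"
  shows "f v = 0"
proof -
  define h where "h = length H"
  note f = f[unfolded null_function_altan2_iff[OF G], folded h_def]
  define s where "s = (\<Sum>j<h. alt h j * f (NewY j))"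
  have old: "f (Old (Old u)) = 0" if "u \<in> pverts G" for u
    using zero[of "Old u"] that by (simp add: altan_collapse_simps pverts_altan_graph)
  have x: "f (Old (NewX i)) = 0" if "i < h" for i
    using zero[of "NewX i"] that by (simp add: altan_collapse_simps pverts_altan_graph h_def)
  have y: "f (Old (NewY i)) = - (s * alt h i)" if "i < h" for i
    using zero[of "NewY i"] that
    by (simp add: altan_collapse_simps pverts_altan_graph s_def h_def)
  have x': "f (NewX i) = 0" if "i < h" for i
    using f x that by (auto simp: cyc_next_less)
  have y': "f (NewY i) + f (NewY (cyc_prev h i)) = s * alt h i" if "i < h" for i
    using f y that by fastforce
  have "s * (\<Sum>i<h. alt h i * alt h i)
      = (\<Sum>i<h. alt h i * (f (NewY i) + f (NewY (cyc_prev h i))))"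
    unfolding sum_distrib_left by (rule sum.cong) (auto simp: y')
  also have "\<dots> = 0" by (rule sum_alt_mult_cyc_prev)
  finally have s_alt: "s * alt h i = 0" if "i < h" for i
    using sum_alt_alt_eq_0_imp[OF _ that] by auto
  have y'_alt: "f (NewY i) = f (NewY 0) * alt h i" if "i < h" for i
    by (rule cyc_sum_eq_0_imp_alt[of h "\<lambda>i. f (NewY i)"]) (use that y' s_alt in auto)
  have "s = (\<Sum>j<h. f (NewY 0) * (alt h j * alt h j))"
    unfolding s_def
  proof (rule sum.cong)
    fix j assume "j \<in> {..<h}"
    then have "f (NewY j) = f (NewY 0) * alt h j" using y'_alt by blast
    then show "alt h j * f (NewY j) = f (NewY 0) * (alt h j * alt h j)"
      by (simp only: mult.left_commute)
  qed simp
  then have s_eq: "s = f (NewY 0) * (\<Sum>j<h. alt h j * alt h j)"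
    by (simp add: sum_distrib_left)
  have y'0: "f (NewY i) = 0" if i: "i < h" for i
  proof (cases "alt h i = 0")
    case True
    then show ?thesis using y'_alt[OF i] by simp
  next
    case False
    then have "s = 0" "(\<Sum>j<h. alt h j * alt h j) \<noteq> 0"
      using s_alt[OF i] sum_alt_alt_eq_0_imp[OF _ i] by auto
    then show ?thesis using s_eq y'_alt[OF i] by simp
  qed
  show ?thesis
    using v old x y s_alt x' y'0
    by (auto simp: pverts_altan_graph h_def[symmetric])
qed

text \<open>
  Split the given \<open>NewY\<close> values into a multiple of \<open>alt h\<close> and a part
  orthogonal to it. The orthogonal part is the negative of a cyclic sum of some outer values
  \<open>y'\<close>, and adding a multiple of \<open>alt h\<close> to \<open>y'\<close> adjusts the
  correction term to the first part.
\<close>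

lemma altan_collapse_surj:
  assumes G: "pair_graph G" "attachment_set G H"
    and g: "null_function (altan_graph G H) g"
  shows "\<exists>f. null_function (altan_graph (altan_graph G H) (map NewY [0..<length H])) f \<and>
    (\<forall>w\<in>pverts (altan_graph G H). altan_collapse (length H) f w = g w)"
proof -
  define h where "h = length H"
  note g = g[unfolded null_function_altan_iff[OF G], folded h_def]
  let ?y = "\<lambda>i. g (NewY i)"
  define n where "n = (\<Sum>i<h. alt h i * alt h i)"
  \<comment> \<open>For odd \<open>h\<close> this divides by \<open>n = 0\<close>, which is harmless: the multiples
    of \<open>alt h\<close> by \<open>c\<close> and by \<open>t\<close> below are then zero.\<close>
  define c where "c = (\<Sum>i<h. alt h i * ?y i) / n"
  have alt0: "alt h i = 0" if "n = 0" "i < h" for i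
    by (rule sum_alt_alt_eq_0_imp[OF that(1)[unfolded n_def] that(2)])
  have "(\<Sum>i<h. alt h i * (c * alt h i - ?y i)) = c * n - (\<Sum>i<h. alt h i * ?y i)"
    by (simp add: n_def sum_distrib_left right_diff_distrib sum_subtractf mult.left_commute)
  also have "\<dots> = 0" by (cases "n = 0") (auto simp: c_def alt0)
  finally have "(\<Sum>i<h. alt h i * (c * alt h i - ?y i)) = 0" .
  from ex_cyc_sum_eq[OF this]
  obtain w where w: "\<And>i. i < h \<Longrightarrow> w i + w (cyc_prev h i) = c * alt h i - ?y i"
    by blast
  define t where "t = (c - (\<Sum>i<h. alt h i * w i)) / n"
  define y' where "y' i = w i + t * alt h i" for i
  have y': "y' i + y' (cyc_prev h i) = c * alt h i - ?y i" if "i < h" for i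
    using w[OF that] that by (simp add: y'_def alt_cyc_prev)
  have "(\<Sum>i<h. alt h i * y' i) = (\<Sum>i<h. alt h i * w i) + t * n"
    by (simp add: y'_def n_def sum_distrib_left distrib_left sum.distrib mult.left_commute)
  then have s: "(\<Sum>j<h. alt h j * y' j) * alt h i = c * alt h i" if "i < h" for i
    using alt0[OF _ that] by (cases "n = 0") (auto simp: t_def)
  define f where "f v = (case v of
      Old (NewY i) \<Rightarrow> ?y i - c * alt h i | Old u \<Rightarrow> g u | NewX i \<Rightarrow> 0 | NewY i \<Rightarrow> y' i)"
    for v :: "'a altan_vertex altan_vertex"
  have f_simps: "f (Old (Old u)) = g (Old u)" "f (Old (NewX i)) = g (NewX i)"
    "f (Old (NewY i)) = ?y i - c * alt h i" "f (NewX i) = 0" "f (NewY i) = y' i" for u i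
    by (simp_all add: f_def)
  have "null_function (altan_graph (altan_graph G H) (map NewY [0..<length H])) f"
    unfolding null_function_altan2_iff[OF G] f_simps
    using g y' unfolding h_def[symmetric] by (auto simp: alt_cyc_prev add.assoc)
  moreover have "altan_collapse h f w = g w" if "w \<in> pverts (altan_graph G H)" for w
    using that by (auto simp: pverts_altan_graph altan_collapse_simps f_simps s h_def[symmetric])
  ultimately show ?thesis unfolding h_def by blast
qed

theorem theorem14:
  fixes G :: "'a pair_pre_digraph" and H :: "'a list"
  assumes "pair_graph G"
    and "attachment_set G H"
  shows "nullity (fst (altan (G, H))) = nullity (fst (altan2 (G, H)))"
proof -
  let ?h = "length H"
  let ?G1 = "altan_graph G H" and ?G2 = "altan_graph (altan_graph G H) (map NewY [0..<length H])"
  have G1: "pair_graph ?G1"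
    using pair_graph_altan[OF assms] by (simp add: altan_simps)
  have "attachment_set ?G1 (map NewY [0..<?h])"
    using attachment_set_altan[OF assms(2)] by (simp add: altan_def)
  from pair_graph_altan[OF G1 this] have G2: "pair_graph ?G2"
    by (simp add: altan_simps)
  have "nullity ?G2 = nullity ?G1"
  proof (rule nullity_eqI[where T = "altan_collapse ?h", OF G2 G1])
    fix f g :: "'a altan_vertex altan_vertex \<Rightarrow> real" and w
    assume eq: "\<And>v. v \<in> pverts ?G2 \<Longrightarrow> f v = g v" and w: "w \<in> pverts ?G1"
    have "(\<Sum>j<?h. alt ?h j * f (NewY j)) = (\<Sum>j<?h. alt ?h j * g (NewY j))"
      by (rule sum.cong) (auto simp: eq pverts_altan_graph)
    moreover have "f (Old w) = g (Old w)"
      using w by (intro eq) (auto simp: pverts_altan_graph)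
    ultimately show "altan_collapse ?h f w = altan_collapse ?h g w"
      by (simp add: altan_collapse_def split: altan_vertex.split)
  next
    fix f g :: "'a altan_vertex altan_vertex \<Rightarrow> real" and w
    show "altan_collapse ?h (\<lambda>v. f v + g v) w = altan_collapse ?h f w + altan_collapse ?h g w"
      by (simp add: altan_collapse_def distrib_left distrib_right sum.distrib
          split: altan_vertex.split)
  next
    fix c and f :: "'a altan_vertex altan_vertex \<Rightarrow> real" and w
    show "altan_collapse ?h (\<lambda>v. c * f v) w = c * altan_collapse ?h f w"
      by (simp add: altan_collapse_def distrib_left sum_distrib_left mult.left_commute mult.assoc
          sum_distrib_right split: altan_vertex.split)
  qed (fact altan_collapse_null[OF assms] altan_collapse_inj[OF assms]
      altan_collapse_surj[OF assms])+
  then show ?thesis by (simp add: altan_simps)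
qed

end
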